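(* Let $(C_i\subseteq\mathbb F_q^{n_i})_{i\in[t]}$, $t\ge2$, be classical codes with product-expansion $\rho>0$, and suppose $C_t\neq\mathbb F_q^{n_t}$. Then the subcollection $(C_i)_{i\in[t-1]}$ has product-expansion at least $\rho$.
   Context: Product-expansion: For codes $C_1\subseteq\mathbb F_q^{n_1},\dots,C_t\subseteq\mathbb F_q^{n_t}$, identify $\mathbb F_q^{n_1}\otimes\cdots\otimes\mathbb F_q^{n_t}$ with $t$-dimensional arrays; a direction-$i$ column is the vector in $\mathbb F_q^{n_i}$ obtained by fixing all coordinates except the $i$-th. $C^{(i)}$ is the space of arrays all of whose direction-$i$ columns lie in $C_i$, and $C_1\boxplus\cdots\boxplus C_t=C^{(1)}+\cdots+C^{(t)}$. $|c|$ is the number of nonzero entries of an array, $|c|_i$ its number of nonzero direction-$i$ columns. The product-expansion of $(C_i)_{i\in[t]}$ is the largest $\rho\ge0$ such that every $c\in C_1\boxplus\cdots\boxplus C_t$ has a decomposition $c=c_1+\cdots+c_t$ with $c_i\in C^{(i)}$ and $|c|\ge\rho\sum_in_i|c_i|_i$. *)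

theory Defs
  imports Main "HOL-Library.Extended_Real"
begin

text \<open>The field F_q is a finite field type 'a (q = CARD('a)).
  A t-dimensional array of shape n_0 x ... x n_(t-1) (indices 0-based) is a function
  (nat => nat) => 'a vanishing outside the box below.\<close>

definition vecs :: "nat \<Rightarrow> (nat \<Rightarrow> 'a::zero) set" where
  "vecs m = {v. \<forall>j\<ge>m. v j = 0}"

definition linear_code :: "nat \<Rightarrow> (nat \<Rightarrow> 'a::field) set \<Rightarrow> bool" where
  "linear_code m C \<longleftrightarrow> C \<subseteq> vecs m \<and> (\<lambda>_. 0) \<in> C \<and>
     (\<forall>u\<in>C. \<forall>v\<in>C. (\<lambda>j. u j + v j) \<in> C) \<and>
     (\<forall>a. \<forall>v\<in>C. (\<lambda>j. a * v j) \<in> C)"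

definition box :: "(nat \<Rightarrow> nat) \<Rightarrow> nat \<Rightarrow> (nat \<Rightarrow> nat) set" where
  "box n t = {x. (\<forall>i<t. x i < n i) \<and> (\<forall>i\<ge>t. x i = 0)}"

definition arrays :: "(nat \<Rightarrow> nat) \<Rightarrow> nat \<Rightarrow> ((nat \<Rightarrow> nat) \<Rightarrow> 'a::zero) set" where
  "arrays n t = {c. \<forall>x. x \<notin> box n t \<longrightarrow> c x = 0}"

definition col :: "(nat \<Rightarrow> nat) \<Rightarrow> ((nat \<Rightarrow> nat) \<Rightarrow> 'a::zero) \<Rightarrow> (nat \<Rightarrow> nat) \<Rightarrow> nat \<Rightarrow> (nat \<Rightarrow> 'a)" where
  "col n c x i = (\<lambda>j. if j < n i then c (x(i := j)) else 0)"

definition dir_code :: "(nat \<Rightarrow> nat) \<Rightarrow> nat \<Rightarrow> (nat \<Rightarrow> (nat \<Rightarrow> 'a::zero) set) \<Rightarrow> nat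
    \<Rightarrow> ((nat \<Rightarrow> nat) \<Rightarrow> 'a) set" where
  "dir_code n t C i = {c \<in> arrays n t. \<forall>x\<in>box n t. col n c x i \<in> C i}"

definition boxplus :: "(nat \<Rightarrow> nat) \<Rightarrow> nat \<Rightarrow> (nat \<Rightarrow> (nat \<Rightarrow> 'a::comm_monoid_add) set)
    \<Rightarrow> ((nat \<Rightarrow> nat) \<Rightarrow> 'a) set" where
  "boxplus n t C = {c. \<exists>cs. (\<forall>i<t. cs i \<in> dir_code n t C i) \<and> c = (\<lambda>x. \<Sum>i<t. cs i x)}"

definition wt :: "(nat \<Rightarrow> nat) \<Rightarrow> nat \<Rightarrow> ((nat \<Rightarrow> nat) \<Rightarrow> 'a::zero) \<Rightarrow> nat" where
  "wt n t c = card {x \<in> box n t. c x \<noteq> 0}"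

text \<open>|c|_i: number of nonzero direction-i columns (each column represented by its
  position with i-th coordinate 0).\<close>
definition col_wt :: "(nat \<Rightarrow> nat) \<Rightarrow> nat \<Rightarrow> ((nat \<Rightarrow> nat) \<Rightarrow> 'a::zero) \<Rightarrow> nat \<Rightarrow> nat" where
  "col_wt n t c i = card {x \<in> box n t. x i = 0 \<and> col n c x i \<noteq> (\<lambda>_. 0)}"

definition has_pe :: "(nat \<Rightarrow> nat) \<Rightarrow> nat \<Rightarrow> (nat \<Rightarrow> (nat \<Rightarrow> 'a::comm_monoid_add) set) \<Rightarrow> real \<Rightarrow> bool" where
  "has_pe n t C \<rho> \<longleftrightarrow> (\<forall>c\<in>boxplus n t C. \<exists>cs. (\<forall>i<t. cs i \<in> dir_code n t C i) \<and>
      c = (\<lambda>x. \<Sum>i<t. cs i x) \<and>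
      real (wt n t c) \<ge> \<rho> * (\<Sum>i<t. real (n i) * real (col_wt n t (cs i) i)))"

text \<open>Product-expansion: the largest such rho \<ge> 0 (as an extended real, in order to
  cover the degenerate case where every rho works).\<close>
definition product_expansion :: "(nat \<Rightarrow> nat) \<Rightarrow> nat \<Rightarrow> (nat \<Rightarrow> (nat \<Rightarrow> 'a::comm_monoid_add) set) \<Rightarrow> ereal" where
  "product_expansion n t C = Sup {ereal \<rho> | \<rho>. \<rho> \<ge> 0 \<and> has_pe n t C \<rho>}"

end

theory Submission
  imports Defs "HOL-Library.Function_Algebras" "HOL-Library.FuncSet"
begin

text \<open>Fix a coordinate \<open>j\<close> and a dual word \<open>f\<close> of \<open>C\<^sub>t\<close> with \<open>f j = 1\<close>; it exists because
  \<open>C\<^sub>t\<close> is a proper subspace. A codeword \<open>c\<close> of the \<open>(t-1)\<close>-fold product is placed on the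
  slice \<open>x\<^sub>t = j\<close> of the \<open>t\<close>-fold array, where it is a codeword of the \<open>t\<close>-fold product of
  the same weight. Decompose it there with expansion \<open>\<rho>\<close>, and contract every summand along
  direction \<open>t\<close> with \<open>f\<close>. The contraction maps \<open>C\<^sup>(\<^sup>i\<^sup>)\<close> into \<open>C\<^sup>(\<^sup>i\<^sup>)\<close> for \<open>i < t\<close> without
  increasing column weights, kills \<open>C\<^sup>(\<^sup>t\<^sup>)\<close>, and returns \<open>c\<close> from its embedding. This gives
  a decomposition of \<open>c\<close> with expansion \<open>\<rho>\<close>; the factor \<open>n\<^sub>t\<close> dropped from the weights only
  helps.\<close>

context vector_space
begin

lemma exists_functional_vanishing_on_subspace:
  assumes "subspace S" and "e \<notin> S"
  shows "\<exists>g. Vector_Spaces.linear scale (*) g \<and> g e = 1 \<and> (\<forall>v\<in>S. g v = 0)"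
proof -
  interpret F: vector_space "(*) :: 'a \<Rightarrow> 'a \<Rightarrow> 'a"
    by unfold_locales (auto simp: algebra_simps)
  interpret P: vector_space_pair scale "(*) :: 'a \<Rightarrow> 'a \<Rightarrow> 'a" ..
  obtain B where B: "B \<subseteq> S" "independent B" "S \<subseteq> span B"
    by (rule maximal_independent_subset)
  have "e \<notin> span B"
    using span_minimal[OF B(1) assms(1)] assms(2) by auto
  then have ind: "independent (insert e B)"
    using independent_insertI B(2) by blast
  obtain g where g: "Vector_Spaces.linear scale (*) g"
      "\<forall>x\<in>insert e B. g x = (if x = e then 1 else 0)"
    using P.linear_independent_extend[OF ind, of "\<lambda>x. if x = e then 1 else 0"] by blast
  interpret G: Vector_Spaces.linear scale "(*) :: 'a \<Rightarrow> 'a \<Rightarrow> 'a" g by fact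
  have "g x = 0" if "x \<in> B" for x
    using g(2) that \<open>e \<notin> span B\<close> span_base by force
  then have "\<forall>v\<in>S. g v = 0"
    using B(3) G.eq_0_on_span by blast
  with g show ?thesis by auto
qed

end

lemma linear_code_sum_scaled:
  assumes lc: "linear_code m C" and "finite I" and "\<forall>i\<in>I. u i \<in> C"
  shows "(\<lambda>j. \<Sum>i\<in>I. a i * u i j) \<in> C"
  using \<open>finite I\<close> \<open>\<forall>i\<in>I. u i \<in> C\<close>
proof (induction I rule: finite_induct)
  case empty
  then show ?case using lc by (simp add: linear_code_def)
next
  case (insert x F)
  from lc have add: "\<And>v w. v \<in> C \<Longrightarrow> w \<in> C \<Longrightarrow> (\<lambda>j. v j + w j) \<in> C"
    and scale: "\<And>b v. v \<in> C \<Longrightarrow> (\<lambda>j. b * v j) \<in> C"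
    unfolding linear_code_def by blast+
  have "(\<lambda>j. a x * u x j + (\<Sum>i\<in>F. a i * u i j)) \<in> C"
    using insert.IH insert.prems by (intro add scale) auto
  then show ?case using insert.hyps by simp
qed

lemma sum_fun_apply: "(\<Sum>a\<in>A. F a) x = (\<Sum>a\<in>A. F a x :: 'b::comm_monoid_add)"
  by (induction A rule: infinite_finite_induct) auto

definition unit_vec :: "nat \<Rightarrow> nat \<Rightarrow> 'a::zero_neq_one" where
  "unit_vec j = (\<lambda>l. if l = j then 1 else 0)"

lemma vecs_eq_sum_unit_vec:
  fixes v :: "nat \<Rightarrow> 'a::field"
  assumes "v \<in> vecs m"
  shows "v = (\<lambda>l. \<Sum>j<m. v j * unit_vec j l)"
proof
  fix l
  have "(\<Sum>j<m. v j * unit_vec j l) = (\<Sum>j<m. if l = j then v j else 0)"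
    by (rule sum.cong) (auto simp: unit_vec_def)
  then show "v l = (\<Sum>j<m. v j * unit_vec j l)"
    using assms by (simp add: vecs_def)
qed

lemma proper_linear_code_misses_unit_vec:
  assumes lc: "linear_code m C" and "C \<noteq> vecs m"
  shows "\<exists>j<m. unit_vec j \<notin> C"
proof (rule ccontr)
  assume "\<not> ?thesis"
  then have "\<forall>j\<in>{..<m}. unit_vec j \<in> C" by auto
  then have "v \<in> C" if "v \<in> vecs m" for v
    using linear_code_sum_scaled[OF lc, of "{..<m}" unit_vec v]
    by (subst vecs_eq_sum_unit_vec[OF that]) simp
  with assms show False unfolding linear_code_def by blast
qed

lemma proper_linear_code_dual_word:
  fixes C :: "(nat \<Rightarrow> 'a::field) set"
  assumes lc: "linear_code m C" and "C \<noteq> vecs m"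
  obtains j f where "j < m" "f j = 1" "\<forall>v\<in>C. (\<Sum>l<m. f l * v l) = 0"
proof -
  obtain j where j: "j < m" "unit_vec j \<notin> C"
    using proper_linear_code_misses_unit_vec[OF assms] by blast
  interpret V: vector_space "\<lambda>a (v :: nat \<Rightarrow> 'a) l. a * v l"
    by unfold_locales (auto simp: algebra_simps fun_eq_iff)
  have "V.subspace C"
    using lc unfolding linear_code_def V.subspace_def zero_fun_def plus_fun_def by auto
  then obtain g where g: "Vector_Spaces.linear (\<lambda>a v l. a * v l) (*) g"
      "g (unit_vec j) = 1" "\<forall>v\<in>C. g v = (0 :: 'a)"
    using V.exists_functional_vanishing_on_subspace j(2) by blast
  interpret G: Vector_Spaces.linear "\<lambda>a (v :: nat \<Rightarrow> 'a) l. a * v l" "(*)" g by fact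
  have "(\<Sum>l<m. g (unit_vec l) * v l) = 0" if "v \<in> C" for v
  proof -
    have "v \<in> vecs m" using lc that unfolding linear_code_def by auto
    then have "g v = g (\<lambda>x. \<Sum>l<m. v l * unit_vec l x)"
      by (subst vecs_eq_sum_unit_vec) auto
    also have "\<dots> = g (\<Sum>l<m. (\<lambda>x. v l * unit_vec l x))"
      by (rule arg_cong[where f = g]) (simp add: fun_eq_iff sum_fun_apply)
    also have "\<dots> = (\<Sum>l<m. v l * g (unit_vec l))"
      using G.scale by (simp add: G.sum)
    also have "\<dots> = (\<Sum>l<m. g (unit_vec l) * v l)"
      by (simp add: mult.commute)
    finally show ?thesis
      using g(3) that by metis
  qed
  with j(1) g(2) show ?thesis
    by (intro that[of j "\<lambda>l. g (unit_vec l)"]) auto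
qed

lemma finite_box: "finite (box n t)"
proof -
  have "inj_on (\<lambda>x. restrict x {..<t}) (box n t)"
  proof (rule inj_onI)
    fix x y assume x: "x \<in> box n t" and y: "y \<in> box n t"
      and eq: "restrict x {..<t} = restrict y {..<t}"
    show "x = y"
    proof
      fix i show "x i = y i"
        using fun_cong[OF eq, of i] x y by (cases "i < t") (auto simp: box_def)
    qed
  qed
  moreover have "(\<lambda>x. restrict x {..<t}) ` box n t \<subseteq> PiE {..<t} (\<lambda>i. {..<n i})"
    by (intro image_subsetI, subst restrict_PiE_iff) (auto simp: box_def)
  ultimately show ?thesis
    using finite_PiE[of "{..<t}" "\<lambda>i. {..<n i}"] finite_imageD finite_subset by blast
qed

lemma box_coord_dim_eq_0: "x \<in> box n t \<Longrightarrow> x t = 0"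
  by (simp add: box_def)

lemma upd_mem_box_Suc: "y \<in> box n k \<Longrightarrow> l < n k \<Longrightarrow> y(k := l) \<in> box n (Suc k)"
  by (auto simp: box_def less_Suc_eq)

lemma upd_0_mem_box: "x \<in> box n (Suc k) \<Longrightarrow> x(k := 0) \<in> box n k"
  by (auto simp: box_def less_Suc_eq)

lemma upd_mem_box_Suc_iff:
  "y k = 0 \<Longrightarrow> l < n k \<Longrightarrow> y(k := l) \<in> box n (Suc k) \<longleftrightarrow> y \<in> box n k"
  by (auto simp: box_def less_Suc_eq Suc_le_eq) (metis Suc_le_eq le_neq_implies_less)

lemma zero_mem_dir_code: "(\<lambda>_. 0) \<in> C i \<Longrightarrow> (\<lambda>_. 0) \<in> dir_code n t C i"
  by (simp add: dir_code_def arrays_def col_def)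

lemma boxplus_subset_arrays: "boxplus n t C \<subseteq> arrays n t"
  by (auto simp: boxplus_def dir_code_def arrays_def)

definition embed_slice :: "nat \<Rightarrow> nat \<Rightarrow> ((nat \<Rightarrow> nat) \<Rightarrow> 'a::zero) \<Rightarrow> (nat \<Rightarrow> nat) \<Rightarrow> 'a" where
  "embed_slice k j c = (\<lambda>x. if x k = j then c (x(k := 0)) else 0)"

lemma col_embed_slice:
  "i \<noteq> k \<Longrightarrow> col n (embed_slice k j c) x i = (if x k = j then col n c (x(k := 0)) i else (\<lambda>_. 0))"
  by (auto simp: fun_eq_iff col_def embed_slice_def fun_upd_twist)

lemma embed_slice_dir_code:
  assumes "c \<in> dir_code n k C i" "i < k" "j < n k" "(\<lambda>_. 0) \<in> C i"
  shows "embed_slice k j c \<in> dir_code n (Suc k) C i"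
proof -
  have "embed_slice k j c x = 0" if "x \<notin> box n (Suc k)" for x
  proof (cases "x k = j")
    case True
    then have "x(k := 0) \<notin> box n k"
      using upd_mem_box_Suc_iff[of "x(k := 0)" k j n] that \<open>j < n k\<close> by auto
    then show ?thesis using assms(1) by (simp add: embed_slice_def dir_code_def arrays_def)
  qed (simp add: embed_slice_def)
  moreover have "col n (embed_slice k j c) x i \<in> C i" if "x \<in> box n (Suc k)" for x
    using assms upd_0_mem_box[OF that] by (auto simp: col_embed_slice dir_code_def)
  ultimately show ?thesis by (simp add: dir_code_def arrays_def)
qed

lemma embed_slice_boxplus:
  assumes "c \<in> boxplus n k C" "j < n k" "\<forall>i<Suc k. (\<lambda>_. 0) \<in> C i"
  shows "embed_slice k j c \<in> boxplus n (Suc k) C"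
proof -
  obtain cs where cs: "\<forall>i<k. cs i \<in> dir_code n k C i" and c: "c = (\<lambda>x. \<Sum>i<k. cs i x)"
    using assms(1) unfolding boxplus_def by blast
  define ds where "ds i = (if i < k then embed_slice k j (cs i) else (\<lambda>_. 0))" for i
  have "\<forall>i<Suc k. ds i \<in> dir_code n (Suc k) C i"
    using cs assms(2,3) by (auto simp: ds_def less_Suc_eq embed_slice_dir_code zero_mem_dir_code)
  moreover have "embed_slice k j c = (\<lambda>x. \<Sum>i<Suc k. ds i x)"
    by (auto simp: fun_eq_iff c ds_def embed_slice_def)
  ultimately show ?thesis unfolding boxplus_def by blast
qed

lemma wt_embed_slice:
  assumes "j < n k"
  shows "wt n (Suc k) (embed_slice k j c) = wt n k c"
proof -
  have "bij_betw (\<lambda>x. x(k := 0)) {x \<in> box n (Suc k). embed_slice k j c x \<noteq> 0}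
      {y \<in> box n k. c y \<noteq> 0}"
  proof (rule bij_betw_byWitness[where f' = "\<lambda>y. y(k := j)"])
    show "\<forall>x\<in>{x \<in> box n (Suc k). embed_slice k j c x \<noteq> 0}. x(k := 0, k := j) = x"
      by (auto simp: embed_slice_def split: if_splits)
    show "\<forall>y\<in>{y \<in> box n k. c y \<noteq> 0}. y(k := j, k := 0) = y"
      using box_coord_dim_eq_0 by fastforce
    show "(\<lambda>x. x(k := 0)) ` {x \<in> box n (Suc k). embed_slice k j c x \<noteq> 0} \<subseteq> {y \<in> box n k. c y \<noteq> 0}"
      using upd_0_mem_box by (auto simp: embed_slice_def split: if_splits)
    show "(\<lambda>y. y(k := j)) ` {y \<in> box n k. c y \<noteq> 0} \<subseteq> {x \<in> box n (Suc k). embed_slice k j c x \<noteq> 0}"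
      using upd_mem_box_Suc assms box_coord_dim_eq_0
      by (auto simp: embed_slice_def) (metis fun_upd_triv)
  qed
  then show ?thesis unfolding wt_def by (rule bij_betw_same_card)
qed

definition contract_along ::
    "(nat \<Rightarrow> nat) \<Rightarrow> nat \<Rightarrow> (nat \<Rightarrow> 'a::semiring_0) \<Rightarrow> ((nat \<Rightarrow> nat) \<Rightarrow> 'a) \<Rightarrow> (nat \<Rightarrow> nat) \<Rightarrow> 'a" where
  "contract_along n k f c = (\<lambda>y. if y k = 0 then \<Sum>l<n k. f l * c (y(k := l)) else 0)"

lemma col_contract_along:
  assumes "y k = 0" "i \<noteq> k"
  shows "col n (contract_along n k f c) y i = (\<lambda>m. \<Sum>l<n k. f l * col n c (y(k := l)) i m)"
proof
  fix m
  have "(y(i := m))(k := l) = (y(k := l))(i := m)" for l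
    using assms(2) by (simp add: fun_upd_twist)
  then show "col n (contract_along n k f c) y i m = (\<Sum>l<n k. f l * col n c (y(k := l)) i m)"
    using assms by (simp add: col_def contract_along_def)
qed

lemma contract_along_dir_code:
  assumes "linear_code (n i) (C i)" "c \<in> dir_code n (Suc k) C i" "i < k"
  shows "contract_along n k f c \<in> dir_code n k C i"
proof -
  have "contract_along n k f c y = 0" if "y \<notin> box n k" for y
  proof (cases "y k = 0")
    case True
    have "c (y(k := l)) = 0" if "l < n k" for l
      using upd_mem_box_Suc_iff[of y k l n] True that \<open>y \<notin> box n k\<close> assms(2)
      by (simp add: dir_code_def arrays_def)
    then show ?thesis by (simp add: contract_along_def)
  qed (simp add: contract_along_def)
  moreover have "col n (contract_along n k f c) y i \<in> C i" if "y \<in> box n k" for y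
  proof -
    have "\<forall>l\<in>{..<n k}. col n c (y(k := l)) i \<in> C i"
      using assms(2) upd_mem_box_Suc[OF that] by (simp add: dir_code_def)
    from linear_code_sum_scaled[OF assms(1) _ this, of f]
    show ?thesis
      using col_contract_along[of y k i n f c] box_coord_dim_eq_0[OF that] assms(3) by simp
  qed
  ultimately show ?thesis by (simp add: dir_code_def arrays_def)
qed

lemma contract_along_annihilated:
  assumes "c \<in> dir_code n (Suc k) C k" and dual: "\<forall>v\<in>C k. (\<Sum>l<n k. f l * v l) = 0"
  shows "contract_along n k f c = (\<lambda>_. 0)"
proof
  fix y
  show "contract_along n k f c y = 0"
  proof (cases "y k = 0 \<and> y \<in> box n k \<and> 0 < n k")
    case True
    then have "y \<in> box n (Suc k)"
      using upd_mem_box_Suc_iff[of y k 0 n] by (simp add: fun_upd_idem)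
    then have "col n c y k \<in> C k"
      using assms(1) by (simp add: dir_code_def)
    with dual have "(\<Sum>l<n k. f l * col n c y k l) = 0" by blast
    then show ?thesis
      using True by (simp add: contract_along_def col_def)
  next
    case False
    have "c (y(k := l)) = 0" if "y k = 0" "l < n k" "y \<notin> box n k" for l
      using upd_mem_box_Suc_iff[of y k l n] that assms(1)
      by (simp add: dir_code_def arrays_def)
    with False show ?thesis by (auto simp: contract_along_def)
  qed
qed

lemma contract_along_sum:
  "contract_along n k f (\<lambda>x. \<Sum>i\<in>I. cs i x) = (\<lambda>x. \<Sum>i\<in>I. contract_along n k f (cs i) x)"
  by (simp add: fun_eq_iff contract_along_def sum_distrib_left sum.swap[of _ "{..<n k}"])

lemma contract_along_embed_slice:
  fixes c :: "(nat \<Rightarrow> nat) \<Rightarrow> 'a::semiring_1"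
  assumes "c \<in> arrays n k" "j < n k" "f j = 1"
  shows "contract_along n k f (embed_slice k j c) = c"
proof
  fix y
  show "contract_along n k f (embed_slice k j c) y = c y"
  proof (cases "y k = 0")
    case True
    then have "(\<Sum>l<n k. f l * embed_slice k j c (y(k := l))) = (\<Sum>l<n k. if l = j then c y else 0)"
      using assms(3) by (intro sum.cong) (auto simp: embed_slice_def fun_upd_idem)
    with True assms(2) show ?thesis by (simp add: contract_along_def)
  next
    case False
    then have "y \<notin> box n k" using box_coord_dim_eq_0 by metis
    with False assms(1) show ?thesis by (simp add: contract_along_def arrays_def)
  qed
qed

lemma col_wt_contract_along_le:
  assumes "i < k"
  shows "col_wt n k (contract_along n k f c) i \<le> col_wt n (Suc k) c i"
proof -
  let ?S = "{y \<in> box n k. y i = 0 \<and> col n (contract_along n k f c) y i \<noteq> (\<lambda>_. 0)}"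
  let ?T = "{x \<in> box n (Suc k). x i = 0 \<and> col n c x i \<noteq> (\<lambda>_. 0)}"
  have "?S \<subseteq> (\<lambda>x. x(k := 0)) ` ?T"
  proof
    fix y assume y: "y \<in> ?S"
    then have yk: "y k = 0" using box_coord_dim_eq_0 by blast
    have "\<exists>l<n k. col n c (y(k := l)) i \<noteq> (\<lambda>_. 0)"
    proof (rule ccontr)
      assume "\<not> ?thesis"
      then have "col n (contract_along n k f c) y i = (\<lambda>_. 0)"
        using col_contract_along[of y k i n f c] yk assms by (auto simp: fun_eq_iff intro!: sum.neutral)
      with y show False by simp
    qed
    then obtain l where l: "l < n k" "col n c (y(k := l)) i \<noteq> (\<lambda>_. 0)"
      by blast
    then have "y(k := l) \<in> ?T"
      using y assms upd_mem_box_Suc by auto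
    moreover have "y = (y(k := l))(k := 0)"
      using yk by (simp add: fun_upd_idem)
    ultimately show "y \<in> (\<lambda>x. x(k := 0)) ` ?T" by blast
  qed
  then have "card ?S \<le> card ((\<lambda>x. x(k := 0)) ` ?T)"
    by (intro card_mono finite_imageI) (auto intro: finite_subset[OF _ finite_box])
  also have "\<dots> \<le> card ?T"
    by (rule card_image_le) (auto intro: finite_subset[OF _ finite_box])
  finally show ?thesis unfolding col_wt_def .
qed

lemma has_pe_drop_last:
  fixes C :: "nat \<Rightarrow> (nat \<Rightarrow> 'a::field) set"
  assumes lin: "\<forall>i<Suc k. linear_code (n i) (C i)" and proper: "C k \<noteq> vecs (n k)"
    and "r \<ge> 0" and pe: "has_pe n (Suc k) C r"
  shows "has_pe n k C r"
  unfolding has_pe_def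
proof
  fix c assume c: "c \<in> boxplus n k C"
  obtain j f where j: "j < n k" "f j = 1" and dual: "\<forall>v\<in>C k. (\<Sum>l<n k. f l * v l) = 0"
    using proper_linear_code_dual_word[OF _ proper] lin by blast
  have "\<forall>i<Suc k. (\<lambda>_. 0) \<in> C i"
    using lin unfolding linear_code_def by blast
  with c j(1) have "embed_slice k j c \<in> boxplus n (Suc k) C"
    by (rule embed_slice_boxplus)
  then obtain ds where ds: "\<forall>i<Suc k. ds i \<in> dir_code n (Suc k) C i"
    and embed_eq: "embed_slice k j c = (\<lambda>x. \<Sum>i<Suc k. ds i x)"
    and expansion: "real (wt n (Suc k) (embed_slice k j c))
      \<ge> r * (\<Sum>i<Suc k. real (n i) * real (col_wt n (Suc k) (ds i) i))"
    using pe unfolding has_pe_def by blast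
  define cs where "cs i = contract_along n k f (ds i)" for i
  have "\<forall>i<k. cs i \<in> dir_code n k C i"
    using ds lin by (simp add: cs_def contract_along_dir_code)
  moreover have "c = (\<lambda>x. \<Sum>i<k. cs i x)"
  proof -
    have "c = contract_along n k f (embed_slice k j c)"
      using contract_along_embed_slice boxplus_subset_arrays c j by (metis subsetD)
    also have "\<dots> = (\<lambda>x. \<Sum>i<Suc k. cs i x)"
      unfolding embed_eq contract_along_sum cs_def ..
    also have "\<dots> = (\<lambda>x. \<Sum>i<k. cs i x)"
      using contract_along_annihilated[of "ds k" n k C f] dual ds by (simp add: cs_def)
    finally show ?thesis .
  qed
  moreover have "real (wt n k c) \<ge> r * (\<Sum>i<k. real (n i) * real (col_wt n k (cs i) i))"
  proof -
    have "(\<Sum>i<k. real (n i) * real (col_wt n k (cs i) i))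
        \<le> (\<Sum>i<k. real (n i) * real (col_wt n (Suc k) (ds i) i))"
      by (intro sum_mono mult_left_mono) (simp_all add: cs_def col_wt_contract_along_le)
    also have "\<dots> \<le> (\<Sum>i<Suc k. real (n i) * real (col_wt n (Suc k) (ds i) i))"
      by simp
    finally have "r * (\<Sum>i<k. real (n i) * real (col_wt n k (cs i) i))
        \<le> r * (\<Sum>i<Suc k. real (n i) * real (col_wt n (Suc k) (ds i) i))"
      using \<open>r \<ge> 0\<close> by (rule mult_left_mono)
    also have "\<dots> \<le> real (wt n k c)"
      using expansion wt_embed_slice[of j n k c] j(1) by simp
    finally show ?thesis .
  qed
  ultimately show "\<exists>cs. (\<forall>i<k. cs i \<in> dir_code n k C i) \<and> c = (\<lambda>x. \<Sum>i<k. cs i x) \<and>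
      real (wt n k c) \<ge> r * (\<Sum>i<k. real (n i) * real (col_wt n k (cs i) i))"
    by blast
qed

lemma product_expansion_drop_last:
  fixes C :: "nat \<Rightarrow> (nat \<Rightarrow> 'a::field) set"
  assumes "\<forall>i<Suc k. linear_code (n i) (C i)" and "C k \<noteq> vecs (n k)"
  shows "product_expansion n (Suc k) C \<le> product_expansion n k C"
  unfolding product_expansion_def
  using has_pe_drop_last[OF assms] by (intro Sup_subset_mono) auto

theorem lemmaA1:
  fixes C :: "nat \<Rightarrow> (nat \<Rightarrow> 'a::{field,finite}) set"
    and n :: "nat \<Rightarrow> nat" and t :: nat and \<rho> :: real
  assumes "t \<ge> 2"
    and "\<forall>i<t. linear_code (n i) (C i)"
    and "product_expansion n t C = ereal \<rho>"
    and "\<rho> > 0"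
    and "C (t - 1) \<noteq> vecs (n (t - 1))"
  shows "product_expansion n (t - 1) C \<ge> ereal \<rho>"
proof -
  obtain k where t: "t = Suc k"
    using assms(1) by (cases t) auto
  then have "product_expansion n t C \<le> product_expansion n (t - 1) C"
    using product_expansion_drop_last[of k n C] assms(2,5) by simp
  with assms(3) show ?thesis by simp
qed

end
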